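(* Let $F=(F,\mathcal T,\nu,\mathcal G)$ be a $\nu$-semifield$^\dagger$ and $\Lambda=\{\lambda_1,\dots,\lambda_n\}$. The correspondences $f\mapsto\hat f$ (for $f\in F[\Lambda]$) and $h\mapsto\underline h$ (for corner internal $h\in\overline{F(\Lambda)}$) induce a $1:1$ correspondence between hypersurfaces and $1^\nu$-sets of corner internal rational functions: that is, $\mathrm C_{\mathrm{loc}}(f)\mapsto 1_{\mathrm{loc}}(\hat f)$ and $1_{\mathrm{loc}}(h)\mapsto \mathrm C_{\mathrm{loc}}(\underline h)$ are mutually inverse bijections between these two collections.
   Context: **$\nu$-structures.** A semiring$^\dagger$ is a commutative semiring with unit $1$, not required to have a zero (and containing $r_0,r_1$ with $r_0+r_1=1$). A $\nu$-domain$^\dagger$ is a quadruple $(R,\mathcal T,\nu,\mathcal G)$ with $R$ a semiring$^\dagger$, $\mathcal T\subset R$ a cancellative multiplicative submonoid (tangible elements), $\mathcal G$ an ideal of $R$ (ghost elements) with a partial order, and $\nu:R\to\mathcal G$ an idempotent homomorphism with $\nu|_{\mathcal T}$ onto, such that $a+b=a$ if $\nu(a)>\nu(b)$ and $a+b=\nu(a)$ if $\nu(a)=\nu(b)$. It is a $\nu$-semifield$^\dagger$ if $\mathcal T$ is an abelian group. Write $a^\nu=\nu(a)$; $a\cong_\nu b$ means $a^\nu=b^\nu$; $a\ge_\nu b$ means $a^\nu\ge b^\nu$. Set $a^*=a^{-1}$ and $(a^\nu)^*=(a^{-1})^\nu$ for $a\in\mathcal T$; for a function $f$, $f^*(\mathbf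 a)=f(\mathbf a)^*$. **Rational functions.** $\overline{F[\Lambda]}$ is the semiring$^\dagger$ of functions $F^{(n)}\to F$ defined by polynomials over $F$, and $\overline{\mathcal T[\Lambda]}$ its subset defined by polynomials with tangible coefficients. $\overline{F(\Lambda)}$ is the localization of $\overline{F[\Lambda]}$ at $\overline{\mathcal T[\Lambda]}$; its elements $h/g$ are regarded as functions $\mathbf a\mapsto h(\mathbf a)g(\mathbf a)^*$. **Roots.** A point $\mathbf a$ is a ghost root of a polynomial $f$ if $f(\mathbf a)\in\mathcal G$; $\mathrm C_{\mathrm{loc}}(f)\subseteq\mathcal T^{(n)}$ is the set of tangible ghost roots of $f$ (corner locus). A hypersurface is the corner locus of a single polynomial. A kernel root of a rational function $f$ is a point $\mathbf a$ with $f(\mathbf a)\cong_\nu 1$, and $1_{\mathrm{loc}}(f)$ is the set of kernel roots; here it is considered on tangible points. **Hat and underline.** For $f=\sum_{i=1}^k f_i$ written as a sum of monomials, $\hat f=\sum_{i=1}^k f_i\bigl(\sum_{j\ne i}f_j\bigr)^*$. For a rational function $f=h/g$, $\underline f=g+h$. **Corner internal.** $f\in\overline{F(\Lambda)}$ is corner internal if one can write $f=h/g$ with $g,h$ polynomials, $g\in\overline{\mathcal T[\Lambda]}$, such that every ghost root of $g+h$ is a kernel root of $f$. Such a way of writing $f$ is called canonical, and for corner internal $f$ the polynomial $\underline f=g+h$ is formed from a canonical way of writing $f$ ($\mathrm C_{\mathrm{loc}}(\underline f)$ does not depend on which).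
   Formalization: Tangible and ghost elements are taken disjoint, the order on the ghosts is a≤b iff a+b=b, ghost roots in "corner internal" are tangible, and the hat is formed from at least two monomials with tangible coefficients (ghost ones split as c+c); without these the claim fails or is undefined. *)

theory Defs
  imports Main
begin

text \<open>
  The underlying semiring is a whole type of sort \<open>{comm_semiring, comm_monoid_mult}\<close>: a
  commutative semiring with unit in which no zero is available.  Sums are therefore only taken
  over nonempty lists, and polynomials are nonempty sums of monomials.
\<close>

fun sum1 :: "'a::ab_semigroup_add list \<Rightarrow> 'a" where
  "sum1 [x] = x"
| "sum1 (x # y # xs) = x + sum1 (y # xs)"

subsection \<open>Domains and semifields with ghosts\<close>

text \<open>
  \<open>(a, b) \<in> ord\<close> means that \<open>a \<le> b\<close>.  Two conventions are made explicit.
  Tangible elements are not ghosts (\<open>tangible_not_ghost\<close>).  The partial order on \<open>G\<close> is the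
  natural order of the additively idempotent semiring \<open>G\<close>, where \<open>a \<le> b\<close> iff \<open>a + b = b\<close>:
  one direction follows from \<open>add_dominant\<close>, the other is \<open>natural_order\<close>.
  Elements outside \<open>T \<union> G\<close> are not excluded.
\<close>

locale nu_domain =
  fixes T :: "'a::{comm_semiring, comm_monoid_mult} set"
    and \<nu> :: "'a \<Rightarrow> 'a"
    and G :: "'a set"
    and ord :: "('a \<times> 'a) set"
  assumes one_sum: "\<exists>r\<^sub>0 r\<^sub>1 :: 'a. r\<^sub>0 + r\<^sub>1 = 1"
    and one_tangible: "1 \<in> T"
    and mult_tangible: "a \<in> T \<Longrightarrow> b \<in> T \<Longrightarrow> a * b \<in> T"
    and cancel_tangible: "a \<in> T \<Longrightarrow> b \<in> T \<Longrightarrow> c \<in> T \<Longrightarrow> a * b = a * c \<Longrightarrow> b = c"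
    and add_ghost: "a \<in> G \<Longrightarrow> b \<in> G \<Longrightarrow> a + b \<in> G"
    and mult_ghost: "a \<in> G \<Longrightarrow> r * a \<in> G"
    and tangible_not_ghost: "T \<inter> G = {}"
    and ghost_order: "partial_order_on G ord"
    and natural_order: "a \<in> G \<Longrightarrow> b \<in> G \<Longrightarrow> a + b = b \<Longrightarrow> (a, b) \<in> ord"
    and nu_ghost: "\<nu> a \<in> G"
    and nu_idem: "\<nu> (\<nu> a) = \<nu> a"
    and nu_add: "\<nu> (a + b) = \<nu> a + \<nu> b"
    and nu_mult: "\<nu> (a * b) = \<nu> a * \<nu> b"
    and nu_onto: "\<nu> ` T = G"
    and add_dominant: "(\<nu> b, \<nu> a) \<in> ord \<Longrightarrow> \<nu> a \<noteq> \<nu> b \<Longrightarrow> a + b = a"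
    and add_equal: "\<nu> a = \<nu> b \<Longrightarrow> a + b = \<nu> a"

locale nu_semifield = nu_domain +
  assumes inverse_tangible: "a \<in> T \<Longrightarrow> \<exists>b\<in>T. a * b = 1"

definition tangible_inverse :: "'a::{comm_semiring, comm_monoid_mult} set \<Rightarrow> 'a \<Rightarrow> 'a" where
  "tangible_inverse T a = (THE b. b \<in> T \<and> a * b = 1)"

text \<open>
  The operation \<open>*\<close>: \<open>a \<mapsto> a\<^sup>-\<^sup>1\<close> on \<open>T\<close> and
  \<open>\<nu> a \<mapsto> \<nu> (a\<^sup>-\<^sup>1)\<close> on \<open>G = \<nu> ` T\<close>; the value outside \<open>T \<union> G\<close>
  is unspecified.
\<close>

definition star :: "'a::{comm_semiring, comm_monoid_mult} set \<Rightarrow> ('a \<Rightarrow> 'a) \<Rightarrow> 'a \<Rightarrow> 'a" where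
  "star T \<nu> a =
     (if a \<in> T then tangible_inverse T a
      else (THE c. \<exists>t\<in>T. \<nu> t = a \<and> c = \<nu> (tangible_inverse T t)))"

subsection \<open>Polynomials and rational functions, as functions on points\<close>

text \<open>
  The variables are indexed by the finite type \<open>'n\<close>; points are functions \<open>'n \<Rightarrow> 'a\<close>.
  The pair \<open>(c, k)\<close> stands for the monomial \<open>c \<cdot> \<Prod>i. \<lambda>\<^sub>i ^ k i\<close>.
\<close>

type_synonym ('a, 'n) monomial = "'a \<times> ('n \<Rightarrow> nat)"

definition eval_monomial ::
    "('a::{comm_semiring, comm_monoid_mult}, 'n::finite) monomial \<Rightarrow> ('n \<Rightarrow> 'a) \<Rightarrow> 'a" where
  "eval_monomial m x = fst m * (\<Prod>i\<in>UNIV. x i ^ snd m i)"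

definition eval_sum ::
    "('a::{comm_semiring, comm_monoid_mult}, 'n::finite) monomial list \<Rightarrow> ('n \<Rightarrow> 'a) \<Rightarrow> 'a" where
  "eval_sum ms x = sum1 (map (\<lambda>m. eval_monomial m x) ms)"

definition polynomials ::
    "(('n::finite \<Rightarrow> 'a) \<Rightarrow> 'a::{comm_semiring, comm_monoid_mult}) set" where
  "polynomials = {eval_sum ms | ms. ms \<noteq> []}"

text \<open>
  For tangible coefficients the exponents must be distinct, because adding two tangible
  monomials with the same exponent may produce a ghost coefficient.
\<close>

definition tangible_polynomials ::
    "'a set \<Rightarrow> (('n::finite \<Rightarrow> 'a) \<Rightarrow> 'a::{comm_semiring, comm_monoid_mult}) set" where
  "tangible_polynomials T =
     {eval_sum ms | ms. ms \<noteq> [] \<and> distinct (map snd ms) \<and> fst ` set ms \<subseteq> T}"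

definition fraction ::
    "'a::{comm_semiring, comm_monoid_mult} set \<Rightarrow> ('a \<Rightarrow> 'a) \<Rightarrow>
     (('n \<Rightarrow> 'a) \<Rightarrow> 'a) \<Rightarrow> (('n \<Rightarrow> 'a) \<Rightarrow> 'a) \<Rightarrow> ('n \<Rightarrow> 'a) \<Rightarrow> 'a" where
  "fraction T \<nu> h g x = h x * star T \<nu> (g x)"

subsection \<open>Corner loci and kernel roots\<close>

definition tangible_points :: "'a set \<Rightarrow> ('n \<Rightarrow> 'a) set" where
  "tangible_points T = {x. \<forall>i. x i \<in> T}"

definition corner_locus ::
    "'a set \<Rightarrow> 'a set \<Rightarrow> (('n \<Rightarrow> 'a) \<Rightarrow> 'a) \<Rightarrow> ('n \<Rightarrow> 'a) set" where
  "corner_locus T G f = {x \<in> tangible_points T. f x \<in> G}"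

definition one_locus ::
    "'a::one set \<Rightarrow> ('a \<Rightarrow> 'a) \<Rightarrow> (('n \<Rightarrow> 'a) \<Rightarrow> 'a) \<Rightarrow> ('n \<Rightarrow> 'a) set" where
  "one_locus T \<nu> f = {x \<in> tangible_points T. \<nu> (f x) = \<nu> 1}"

definition underline ::
    "(('n \<Rightarrow> 'a) \<Rightarrow> 'a::plus) \<Rightarrow> (('n \<Rightarrow> 'a) \<Rightarrow> 'a) \<Rightarrow> ('n \<Rightarrow> 'a) \<Rightarrow> 'a" where
  "underline h g x = g x + h x"

text \<open>
  The fraction \<open>h / g\<close> is a canonical way of writing \<open>f\<close>.  Both kinds of roots are taken among
  the tangible points.
\<close>

definition canonical ::
    "'a::{comm_semiring, comm_monoid_mult} set \<Rightarrow> ('a \<Rightarrow> 'a) \<Rightarrow> 'a set \<Rightarrow>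
     (('n::finite \<Rightarrow> 'a) \<Rightarrow> 'a) \<Rightarrow> (('n \<Rightarrow> 'a) \<Rightarrow> 'a) \<Rightarrow> (('n \<Rightarrow> 'a) \<Rightarrow> 'a) \<Rightarrow> bool" where
  "canonical T \<nu> G f h g \<longleftrightarrow>
     h \<in> polynomials \<and> g \<in> tangible_polynomials T \<and> f = fraction T \<nu> h g \<and>
     corner_locus T G (underline h g) \<subseteq> one_locus T \<nu> f"

definition corner_internal ::
    "'a::{comm_semiring, comm_monoid_mult} set \<Rightarrow> ('a \<Rightarrow> 'a) \<Rightarrow> 'a set \<Rightarrow>
     (('n::finite \<Rightarrow> 'a) \<Rightarrow> 'a) \<Rightarrow> bool" where
  "corner_internal T \<nu> G f \<longleftrightarrow> (\<exists>h g. canonical T \<nu> G f h g)"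

text \<open>
  The function \<open>\<Sum>\<^sub>i f\<^sub>i (\<Sum>\<^sub>j\<^sub>\<noteq>\<^sub>i f\<^sub>j)\<^sup>*\<close> depends on how \<open>f\<close> is written as a sum
  of monomials and makes sense only for at least two summands, since there is no empty sum.
\<close>

definition hat ::
    "'a::{comm_semiring, comm_monoid_mult} set \<Rightarrow> ('a \<Rightarrow> 'a) \<Rightarrow>
     ('a, 'n::finite) monomial list \<Rightarrow> ('n \<Rightarrow> 'a) \<Rightarrow> 'a" where
  "hat T \<nu> ms x =
     sum1 (map (\<lambda>i. eval_monomial (ms ! i) x *
                   star T \<nu> (eval_sum (take i ms @ drop (Suc i) ms) x))
               [0..<length ms])"

text \<open>
  A way of writing \<open>f\<close> as a sum of at least two tangible monomials.  Repetitions are allowed: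
  a monomial with ghost coefficient \<open>\<nu> c = c + c\<close> (with \<open>c \<in> T\<close>) is written as two copies
  of the same tangible monomial.  With unsplit ghost monomials, \<open>hat\<close> does not detect
  the corner locus: for \<open>\<nu> 1 \<cdot> \<lambda> + 1\<close> the tangible ghost roots are all \<open>x\<close> with
  \<open>\<nu> x \<ge> \<nu> 1\<close>, whereas \<open>(\<nu> 1 \<cdot> \<lambda>) \<cdot> 1\<^sup>* + 1 \<cdot> (\<nu> 1 \<cdot> \<lambda>)\<^sup>*\<close> has only
  the kernel roots with \<open>\<nu> x = \<nu> 1\<close>.
\<close>

definition sum_of_monomials ::
    "'a::{comm_semiring, comm_monoid_mult} set \<Rightarrow> (('n::finite \<Rightarrow> 'a) \<Rightarrow> 'a) \<Rightarrow>
     ('a, 'n) monomial list \<Rightarrow> bool" where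
  "sum_of_monomials T f ms \<longleftrightarrow> 2 \<le> length ms \<and> fst ` set ms \<subseteq> T \<and> f = eval_sum ms"

definition hypersurfaces ::
    "'a::{comm_semiring, comm_monoid_mult} set \<Rightarrow> 'a set \<Rightarrow> ('n::finite \<Rightarrow> 'a) set set" where
  "hypersurfaces T G = {corner_locus T G f | f. f \<in> polynomials}"

definition corner_internal_one_sets ::
    "'a::{comm_semiring, comm_monoid_mult} set \<Rightarrow> ('a \<Rightarrow> 'a) \<Rightarrow> 'a set \<Rightarrow>
     ('n::finite \<Rightarrow> 'a) set set" where
  "corner_internal_one_sets T \<nu> G = {one_locus T \<nu> f | f. corner_internal T \<nu> G f}"

subsection \<open>Consequences of the conventions\<close>

text \<open>
  The natural order on \<open>G\<close> is necessarily total, and every polynomial with coefficients in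
  \<open>T \<union> G\<close> can be written in the form to which \<open>hat\<close> is applied.
\<close>

context nu_domain
begin

lemma ghost_add_idem: "a \<in> G \<Longrightarrow> a + a = a"
  by (metis add_equal nu_idem nu_onto imageE)

lemma ghost_order_total:
  assumes "a \<in> G" "b \<in> G" shows "(a, b) \<in> ord \<or> (b, a) \<in> ord"
proof -
  obtain s t where st: "s \<in> T" "\<nu> s = a" "t \<in> T" "\<nu> t = b" using assms nu_onto by blast
  obtain c where c: "c \<in> T" "\<nu> c = a + b" using add_ghost[OF assms] nu_onto by (metis imageE)
  have 1: "(a, a + b) \<in> ord" "(b, a + b) \<in> ord"
    using assms natural_order add_ghost ghost_add_idem by (metis add.assoc add.commute)+
  have "a = a + b \<or> b = a + b"
  proof (rule ccontr)
    assume "\<not> ?thesis"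
    then have "c + s = c" "c + t = c" using add_dominant[of s c] add_dominant[of t c] st c 1 by metis+
    then have "c + (s + t) = c" by (metis add.assoc)
    moreover have "c + (s + t) = \<nu> c" by (rule add_equal) (simp add: c st nu_add)
    ultimately show False using c tangible_not_ghost nu_ghost by (metis disjoint_iff)
  qed
  then show ?thesis using 1 by metis
qed

end

lemma sum1_append: "xs \<noteq> [] \<Longrightarrow> ys \<noteq> [] \<Longrightarrow> sum1 (xs @ ys) = sum1 xs + sum1 ys"
proof (induction xs rule: sum1.induct)
  case (1 x) then show ?case by (cases ys) auto
next
  case (2 x y xs) then show ?case by (simp add: add.assoc)
qed simp

lemma eval_sum_append: "ms \<noteq> [] \<Longrightarrow> ns \<noteq> [] \<Longrightarrow> eval_sum (ms @ ns) x = eval_sum ms x + eval_sum ns x"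
  by (simp add: eval_sum_def sum1_append)

context nu_domain
begin

lemma ex_negligible_tangible: "\<exists>r\<in>T. \<forall>x. x + r * x = x"
proof -
  obtain p q :: 'a where pq: "p + q = 1" using one_sum by blast
  have ne: "\<nu> p \<noteq> \<nu> q" using add_equal[of p q] pq nu_ghost one_tangible tangible_not_ghost
    by (metis disjoint_iff)
  have *: "\<exists>r\<in>T. \<forall>x. x + r * x = x" if "p + q = 1" "(\<nu> q, \<nu> p) \<in> ord" "\<nu> p \<noteq> \<nu> q" for p q
  proof -
    have "p = 1" using add_dominant that by metis
    obtain r where r: "r \<in> T" "\<nu> r = \<nu> q" using nu_onto nu_ghost by (metis imageE)
    have "1 + r = 1" using add_dominant[of r 1] that r \<open>p = 1\<close> by metis
    then have "x + r * x = x" for x by (metis distrib_right mult_1)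
    then show ?thesis using r by blast
  qed
  show ?thesis using ghost_order_total[OF nu_ghost nu_ghost, of q p] *[of p q] *[of q p] pq ne
    by (metis add.commute)
qed

lemma monomial_eq_tangible_sum:
  assumes "c \<in> T \<union> G"
  shows "\<exists>ms. 2 \<le> length ms \<and> fst ` set ms \<subseteq> T \<and> (\<forall>x. eval_sum ms x = eval_monomial (c,k) x)"
proof (cases "c \<in> T")
  case True
  obtain r where r: "r \<in> T" "\<forall>x. x + r * x = x" using ex_negligible_tangible by blast
  show ?thesis using r True mult_tangible
    by (intro exI[of _ "[(c,k),(r*c,k)]"]) (auto simp: eval_sum_def eval_monomial_def mult.assoc)
next
  case False
  then obtain t where t: "t \<in> T" "\<nu> t = c" using assms nu_onto by (metis UnE imageE)
  have "t + t = c" using add_equal[of t t] t by simp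
  then show ?thesis using t
    by (intro exI[of _ "[(t,k),(t,k)]"]) (auto simp: eval_sum_def eval_monomial_def distrib_right[symmetric])
qed

lemma ex_sum_of_monomials:
  fixes ms :: "('a,'n::finite) monomial list"
  assumes "ms \<noteq> []" "fst ` set ms \<subseteq> T \<union> G"
  shows "\<exists>ns. sum_of_monomials T (eval_sum ms) ns"
  using assms
proof (induction ms rule: list_nonempty_induct)
  case (single m)
  then obtain ns where ns: "2 \<le> length ns" "fst ` set ns \<subseteq> T" "\<forall>x. eval_sum ns x = eval_monomial (fst m, snd m) x"
    using monomial_eq_tangible_sum[of "fst m" "snd m"] by auto
  then have "eval_sum [m] = eval_sum ns" by (auto simp: eval_sum_def[of "[m]"])
  with ns show ?case unfolding sum_of_monomials_def by blast
next
  case (cons m ms)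
  obtain ns where ns: "2 \<le> length ns" "fst ` set ns \<subseteq> T" "\<forall>x. eval_sum ns x = eval_monomial (fst m, snd m) x"
    using monomial_eq_tangible_sum[of "fst m" "snd m"] cons.prems by auto
  obtain ns' where ns': "sum_of_monomials T (eval_sum ms) ns'" using cons by auto
  have "eval_sum (m # ms) x = eval_sum (ns @ ns') x" for x
    using eval_sum_append[of "[m]" ms x] eval_sum_append[of ns ns' x] ns ns' cons.hyps
    by (fastforce simp: sum_of_monomials_def eval_sum_def[of "[m]"])
  then show ?case using ns ns' by (intro exI[of _ "ns @ ns'"]) (auto simp: sum_of_monomials_def)
qed

end

end

theory Submission
  imports Defs
begin

text \<open>
  Both correspondences are the identity on sets of tangible points.  At a tangible point \<open>x\<close> let
  \<open>f\<^sub>i\<close> be a \<open>\<nu>\<close>-maximal monomial of \<open>f\<close> and \<open>s\<^sub>i\<close> the sum of the others.  Then \<open>f x\<close> is a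
  ghost iff \<open>f\<^sub>i\<close> and \<open>s\<^sub>i\<close> have the same \<open>\<nu>\<close>-value, and the \<open>\<nu>\<close>-value of \<open>hat f\<close> is that of
  \<open>f\<^sub>i / s\<^sub>i\<close>; so the kernel roots of \<open>hat f\<close> are the ghost roots of \<open>f\<close>.  For a canonical fraction
  \<open>h / g\<close>, equality of the \<open>\<nu>\<close>-values of \<open>h\<close> and \<open>g\<close> makes \<open>g + h\<close> a ghost, and the converse is
  the definition of canonical.

  To see every hypersurface as the kernel root set of a corner internal function, take \<open>h = f\<^sup>2\<close>
  and \<open>g = \<Sum>\<^sub>i f\<^sub>i s\<^sub>i\<close> in place of numerator and denominator of \<open>hat f\<close>.  Only the \<open>\<nu>\<close>-values of
  \<open>g\<close> matter, since off the corner locus \<open>g + h = h\<close>; so the coefficients of \<open>g\<close> can be made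
  tangible.
\<close>

section \<open>Sums over nonempty lists and closure properties of polynomial functions\<close>

lemma sum1_Cons: "zs \<noteq> [] \<Longrightarrow> sum1 (z # zs) = z + sum1 zs"
  by (cases zs) auto

lemma sum1_remove:
  assumes "as @ bs \<noteq> []"
  shows "sum1 (as @ y # bs) = y + sum1 (as @ bs)"
proof (cases "as = []")
  case True
  then show ?thesis using assms by (simp add: sum1_Cons)
next
  case as: False
  show ?thesis
  proof (cases "bs = []")
    case True
    then show ?thesis using as by (simp add: sum1_append add.commute)
  next
    case False
    then show ?thesis using as by (simp add: sum1_append sum1_Cons add.left_commute)
  qed
qed

lemma sum1_remove_nth:
  assumes "i < length xs" "2 \<le> length xs"
  shows "sum1 xs = xs ! i + sum1 (take i xs @ drop (Suc i) xs)"
proof -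
  \<comment> \<open>There is no empty sum, so something must remain after the removal; for
    \<open>i = 0\<close> it lies in the suffix, otherwise in the prefix.\<close>
  have "take i xs @ drop (Suc i) xs \<noteq> []"
    using assms by (cases i) auto
  then show ?thesis
    using sum1_remove[of "take i xs" "drop (Suc i) xs" "xs ! i"] assms by (simp add: id_take_nth_drop[symmetric])
qed

lemma nth_in_remove_nth:
  assumes "j < length xs" "j \<noteq> i"
  shows "xs ! j \<in> set (take i xs @ drop (Suc i) xs)"
proof (cases "j < i")
  case True
  then have "take i xs ! j = xs ! j" "j < length (take i xs)" using assms by auto
  then have "xs ! j \<in> set (take i xs)" by (metis nth_mem)
  then show ?thesis by simp
next
  case False
  then have "drop (Suc i) xs ! (j - Suc i) = xs ! j" "j - Suc i < length (drop (Suc i) xs)"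
    using assms by auto
  then have "xs ! j \<in> set (drop (Suc i) xs)" by (metis nth_mem)
  then show ?thesis by simp
qed

lemma sum1_distrib_left:
  fixes c :: "'a::comm_semiring"
  shows "xs \<noteq> [] \<Longrightarrow> sum1 (map (\<lambda>x. c * x) xs) = c * sum1 xs"
  by (induction xs rule: list_nonempty_induct) (simp_all add: sum1_Cons distrib_left)

lemma eval_sum_Cons: "ms \<noteq> [] \<Longrightarrow> eval_sum (m # ms) x = eval_monomial m x + eval_sum ms x"
  by (simp add: eval_sum_def sum1_Cons)

lemma eval_sum_singleton: "eval_sum [m] x = eval_monomial m x"
  by (simp add: eval_sum_def)

lemma eval_monomial_mult:
  "eval_monomial (fst m * fst m', \<lambda>i. snd m i + snd m' i) x = eval_monomial m x * eval_monomial m' x"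
  by (simp add: eval_monomial_def power_add prod.distrib mult_ac)

lemma eval_monomial_add_coeff:
  "eval_monomial (c + d, k) x = eval_monomial (c, k) x + eval_monomial (d, k) x"
  by (simp add: eval_monomial_def distrib_right)

lemma polynomials_eval_sum: "ms \<noteq> [] \<Longrightarrow> eval_sum ms \<in> polynomials"
  by (auto simp: polynomials_def)

lemma polynomials_add:
  assumes "p \<in> polynomials" "q \<in> polynomials"
  shows "(\<lambda>x. p x + q x) \<in> polynomials"
proof -
  obtain ms ns where "ms \<noteq> []" "p = eval_sum ms" "ns \<noteq> []" "q = eval_sum ns"
    using assms by (auto simp: polynomials_def)
  then have "(\<lambda>x. p x + q x) = eval_sum (ms @ ns)" by (auto simp: eval_sum_append)
  then show ?thesis using \<open>ms \<noteq> []\<close> by (simp add: polynomials_eval_sum)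
qed

lemma polynomials_mult_monomial:
  assumes "p \<in> polynomials"
  shows "(\<lambda>x. eval_monomial m x * p x) \<in> polynomials"
proof -
  obtain ms where ms: "ms \<noteq> []" "p = eval_sum ms" using assms by (auto simp: polynomials_def)
  define ns where "ns = map (\<lambda>m'. (fst m * fst m', \<lambda>i. snd m i + snd m' i)) ms"
  have "eval_sum ns x = eval_monomial m x * p x" for x
    using sum1_distrib_left[of "map (\<lambda>m'. eval_monomial m' x) ms" "eval_monomial m x"] ms
    by (simp add: ns_def eval_sum_def o_def eval_monomial_mult)
  moreover have "ns \<noteq> []" using ms by (simp add: ns_def)
  ultimately show ?thesis using polynomials_eval_sum[of ns] by presburger
qed

lemma polynomials_sum1:
  assumes "js \<noteq> []" "\<And>j. j \<in> set js \<Longrightarrow> F j \<in> polynomials"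
  shows "(\<lambda>x. sum1 (map (\<lambda>j. F j x) js)) \<in> polynomials"
  using assms
proof (induction js rule: list_nonempty_induct)
  case (cons j js)
  then show ?case using polynomials_add[of "F j" "\<lambda>x. sum1 (map (\<lambda>j. F j x) js)"]
    by (simp add: sum1_Cons)
qed simp

lemma polynomials_mult:
  assumes "p \<in> polynomials" "q \<in> polynomials"
  shows "(\<lambda>x. p x * q x) \<in> polynomials"
proof -
  obtain ms where ms: "ms \<noteq> []" "p = eval_sum ms" using assms by (auto simp: polynomials_def)
  have "(\<lambda>x. p x * q x) = (\<lambda>x. sum1 (map (\<lambda>m. eval_monomial m x * q x) ms))"
  proof
    fix x
    show "p x * q x = sum1 (map (\<lambda>m. eval_monomial m x * q x) ms)"
      using sum1_distrib_left[of "map (\<lambda>m. eval_monomial m x) ms" "q x"] ms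
      by (simp add: eval_sum_def o_def mult.commute)
  qed
  moreover have "(\<lambda>x. sum1 (map (\<lambda>m. eval_monomial m x * q x) ms)) \<in> polynomials"
    using polynomials_sum1[OF ms(1), where F = "\<lambda>m x. eval_monomial m x * q x"]
      polynomials_mult_monomial[OF assms(2)] by blast
  ultimately show ?thesis by simp
qed

section \<open>The total preorder by \<open>\<nu>\<close>-value\<close>

context nu_domain
begin

text \<open>The order on \<open>G\<close> pulled back along \<open>\<nu>\<close>, encoded as the
  natural order of an idempotent semiring: transitivity and compatibility with sums and products
  become semiring identities, and \<open>ord\<close> enters only through totality and
  absorption.\<close>

definition nu_le :: "'a \<Rightarrow> 'a \<Rightarrow> bool" (infix \<open>\<preceq>\<close> 50) where
  "a \<preceq> b \<longleftrightarrow> \<nu> a + \<nu> b = \<nu> b"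

lemma nu_le_refl: "\<nu> a = \<nu> b \<Longrightarrow> a \<preceq> b"
  by (simp add: nu_le_def ghost_add_idem nu_ghost)

lemma nu_le_trans: "a \<preceq> b \<Longrightarrow> b \<preceq> c \<Longrightarrow> a \<preceq> c"
  unfolding nu_le_def by (metis add.assoc)

lemma nu_le_antisym: "a \<preceq> b \<Longrightarrow> b \<preceq> a \<Longrightarrow> \<nu> a = \<nu> b"
  unfolding nu_le_def by (metis add.commute)

text \<open>Inherited from totality of \<open>ord\<close> on \<open>G\<close>: if the values differ,
  \<open>\<nu>\<close> is applied to the absorption law \<open>add_dominant\<close>.\<close>

lemma nu_le_total: "a \<preceq> b \<or> b \<preceq> a"
  unfolding nu_le_def
  by (metis add.commute add_dominant ghost_add_idem ghost_order_total nu_add nu_ghost)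

lemma add_absorb: "a \<preceq> b \<Longrightarrow> \<nu> a \<noteq> \<nu> b \<Longrightarrow> a + b = b"
  unfolding nu_le_def by (metis add.commute add_dominant natural_order nu_ghost)

lemma nu_le_mult: "a \<preceq> b \<Longrightarrow> c * a \<preceq> c * b"
  unfolding nu_le_def by (simp add: nu_mult distrib_left[symmetric])

lemma nu_le_add_left: "a \<preceq> a + b"
  unfolding nu_le_def by (simp add: nu_add add.assoc[symmetric] ghost_add_idem nu_ghost)

lemma nu_le_add_right: "b \<preceq> a + b"
  using nu_le_add_left[of b a] by (simp add: add.commute)

lemma add_nu_le: "a \<preceq> c \<Longrightarrow> b \<preceq> c \<Longrightarrow> a + b \<preceq> c"
  unfolding nu_le_def by (simp add: nu_add add.assoc)

lemma nu_add_of_nu_le: "a \<preceq> b \<Longrightarrow> \<nu> (a + b) = \<nu> b"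
  by (simp add: nu_add nu_le_def)

text \<open>By totality, a sum of two elements is one of the summands or a ghost.\<close>

lemma add_mem_TG: "a \<in> T \<union> G \<Longrightarrow> b \<in> T \<union> G \<Longrightarrow> a + b \<in> T \<union> G"
  using nu_le_total[of a b] add_absorb[of a b] add_absorb[of b a] add_equal[of a b] nu_ghost[of a]
  by (metis UnCI add.commute)

lemma sum1_mem_TG: "xs \<noteq> [] \<Longrightarrow> set xs \<subseteq> T \<union> G \<Longrightarrow> sum1 xs \<in> T \<union> G"
  by (induction xs rule: list_nonempty_induct) (simp, simp add: sum1_Cons add_mem_TG del: Un_iff)

lemma nu_le_sum1: "x \<in> set xs \<Longrightarrow> x \<preceq> sum1 xs"
proof (induction xs)
  case (Cons y ys)
  then show ?case
    by (cases "ys = []")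
      (auto simp: sum1_Cons nu_le_refl nu_le_add_left intro: nu_le_trans nu_le_add_right)
qed simp

lemma sum1_nu_le: "xs \<noteq> [] \<Longrightarrow> (\<And>x. x \<in> set xs \<Longrightarrow> x \<preceq> b) \<Longrightarrow> sum1 xs \<preceq> b"
  by (induction xs rule: list_nonempty_induct) (auto simp: sum1_Cons intro: add_nu_le)

text \<open>A maximal entry bounds the sum from above, and every entry bounds it from below.\<close>

lemma nu_sum1_eqI:
  assumes "x \<in> set xs" "\<And>y. y \<in> set xs \<Longrightarrow> y \<preceq> x"
  shows "\<nu> (sum1 xs) = \<nu> x"
  using assms nu_le_antisym[OF sum1_nu_le nu_le_sum1, of xs x] by (metis list.set_cases list.distinct(1))

lemma ex_nu_max: "xs \<noteq> [] \<Longrightarrow> \<exists>x\<in>set xs. \<forall>y\<in>set xs. y \<preceq> x"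
proof (induction xs rule: list_nonempty_induct)
  case (cons z zs)
  then show ?case using nu_le_total nu_le_trans nu_le_refl by (metis set_ConsD list.set_intros)
qed (simp add: nu_le_refl)

text \<open>Summands of equal \<open>\<nu>\<close>-value add up to a ghost; otherwise the sum is the
  dominant summand. Values and ghostness of the summands therefore decide ghostness of the
  sum.\<close>

lemma ghost_add_cong:
  assumes "\<nu> a = \<nu> a'" "\<nu> b = \<nu> b'" "a \<in> G \<longleftrightarrow> a' \<in> G" "b \<in> G \<longleftrightarrow> b' \<in> G"
  shows "a + b \<in> G \<longleftrightarrow> a' + b' \<in> G"
proof (cases "\<nu> a = \<nu> b")
  case True
  then show ?thesis using assms add_equal nu_ghost by metis
next
  case ne: False
  show ?thesis
  proof (cases "a \<preceq> b")
    case True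
    then have "a' \<preceq> b'" using assms by (simp add: nu_le_def)
    then show ?thesis using assms ne True add_absorb by metis
  next
    case False
    then have "b \<preceq> a" using nu_le_total by blast
    moreover from this have "b' \<preceq> a'" using assms by (simp add: nu_le_def)
    ultimately show ?thesis using assms ne add_absorb by (metis add.commute)
  qed
qed

section \<open>Values at tangible points and replacement of coefficients by tangible ones\<close>

lemma power_tangible: "a \<in> T \<Longrightarrow> a ^ n \<in> T"
  by (induction n) (auto simp: one_tangible mult_tangible)

lemma prod_tangible: "(\<And>i. i \<in> A \<Longrightarrow> u i \<in> T) \<Longrightarrow> prod u A \<in> T"
  by (induction A rule: infinite_finite_induct) (auto simp: one_tangible mult_tangible)

lemma eval_monomial_tangible:
  "x \<in> tangible_points T \<Longrightarrow> fst m \<in> T \<Longrightarrow> eval_monomial m x \<in> T"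
  unfolding eval_monomial_def tangible_points_def
  by (auto intro!: mult_tangible prod_tangible power_tangible)

lemma eval_sum_mem_TG:
  assumes "x \<in> tangible_points T" "ms \<noteq> []" "fst ` set ms \<subseteq> T"
  shows "eval_sum ms x \<in> T \<union> G"
  unfolding eval_sum_def using assms eval_monomial_tangible
  by (intro sum1_mem_TG) auto

lemma ex_tangible_lift: "\<exists>t\<in>T. \<nu> t = \<nu> c"
  using nu_onto nu_ghost by (metis imageE)

lemma nu_eval_monomial_cong: "\<nu> c = \<nu> d \<Longrightarrow> \<nu> (eval_monomial (c, k) x) = \<nu> (eval_monomial (d, k) x)"
  by (simp add: eval_monomial_def nu_mult)

text \<open>Each coefficient is replaced by a tangible lift of its \<open>\<nu>\<close>-value.
  Monomials are inserted one at a time, and those with equal exponents are merged, since tangible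
  polynomials have distinct exponents.\<close>

lemma ex_tangible_polynomial:
  assumes "p \<in> polynomials"
  shows "\<exists>q\<in>tangible_polynomials T. \<forall>x. \<nu> (q x) = \<nu> (p x)"
proof -
  obtain ms where ms: "ms \<noteq> []" "p = eval_sum ms" using assms by (auto simp: polynomials_def)
  have "\<exists>ns. ns \<noteq> [] \<and> distinct (map snd ns) \<and> fst ` set ns \<subseteq> T \<and>
      (\<forall>x. \<nu> (eval_sum ns x) = \<nu> (eval_sum ms x))" using ms(1)
  proof (induction ms rule: list_nonempty_induct)
    case (single m)
    obtain t where "t \<in> T" "\<nu> t = \<nu> (fst m)" using ex_tangible_lift by blast
    then show ?case using nu_eval_monomial_cong[of t "fst m" "snd m"]
      by (intro exI[of _ "[(t, snd m)]"]) (simp add: eval_sum_singleton)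
  next
    case (cons m ms)
    then obtain ns where ns: "ns \<noteq> []" "distinct (map snd ns)" "fst ` set ns \<subseteq> T"
      "\<And>x. \<nu> (eval_sum ns x) = \<nu> (eval_sum ms x)" by blast
    obtain c k where m: "m = (c, k)" by (cases m)
    show ?case
    proof (cases "k \<in> snd ` set ns")
      case False
      obtain t where "t \<in> T" "\<nu> t = \<nu> c" using ex_tangible_lift by blast
      then show ?thesis using ns False m cons.hyps nu_eval_monomial_cong[of t c k]
        by (intro exI[of _ "(t, k) # ns"]) (simp add: eval_sum_Cons nu_add)
    next
      case True
      \<comment> \<open>The exponent already occurs: the old monomial is removed, and a tangible
        lift of the combined coefficient \<open>c + d\<close> goes to the front.\<close>
      then obtain d where "(d, k) \<in> set ns" by auto
      then obtain as bs where ab: "ns = as @ (d, k) # bs" by (meson split_list)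
      obtain t where t: "t \<in> T" "\<nu> t = \<nu> (c + d)" using ex_tangible_lift by blast
      have "\<nu> (eval_sum ((t, k) # as @ bs) x) = \<nu> (eval_sum (m # ms) x)" for x
      proof -
        have 1: "\<nu> (eval_monomial (t, k) x) = \<nu> (eval_monomial (c, k) x) + \<nu> (eval_monomial (d, k) x)"
          using nu_eval_monomial_cong[OF t(2)] by (simp add: eval_monomial_add_coeff nu_add)
        have 2: "\<nu> (eval_sum (m # ms) x) = \<nu> (eval_monomial (c, k) x) + \<nu> (eval_sum ns x)"
          using cons.hyps ns(4) by (simp add: eval_sum_Cons nu_add m)
        show ?thesis
        proof (cases "as @ bs = []")
          case True
          then show ?thesis using 1 2 ab by (simp add: eval_sum_singleton)
        next
          case False
          then have "eval_sum ns x = eval_monomial (d, k) x + eval_sum (as @ bs) x"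
            unfolding eval_sum_def ab
            using sum1_remove[of "map (\<lambda>m. eval_monomial m x) as" "map (\<lambda>m. eval_monomial m x) bs"]
            by simp
          then show ?thesis using 1 2 False by (simp add: eval_sum_Cons nu_add add.assoc)
        qed
      qed
      then show ?thesis using ns ab t
        by (intro exI[of _ "(t, k) # as @ bs"]) auto
    qed
  qed
  then show ?thesis using ms unfolding tangible_polynomials_def by blast
qed

end

section \<open>Inverses up to \<open>\<nu>\<close>, the dominant monomial, and the kernel roots of
  \<open>hat\<close>\<close>

context nu_semifield
begin

lemma tangible_inverse_mem:
  assumes "a \<in> T"
  shows "tangible_inverse T a \<in> T" "a * tangible_inverse T a = 1"
proof -
  have "\<exists>!b. b \<in> T \<and> a * b = 1"
    using assms inverse_tangible cancel_tangible by metis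
  from theI'[OF this] show "tangible_inverse T a \<in> T" "a * tangible_inverse T a = 1"
    unfolding tangible_inverse_def by auto
qed

text \<open>Any \<open>c\<close> can be cancelled, because it shares its \<open>\<nu>\<close>-value
  with an invertible tangible element.\<close>

lemma nu_mult_cancel:
  assumes "\<nu> (a * c) = \<nu> (b * c)" shows "\<nu> a = \<nu> b"
proof -
  obtain t where t: "t \<in> T" "\<nu> t = \<nu> c" using ex_tangible_lift by blast
  obtain s where s: "t * s = 1" using inverse_tangible t by blast
  have "\<nu> e = \<nu> (e * c) * \<nu> s" for e
    using s t by (metis mult.assoc mult.right_neutral nu_mult)
  then show ?thesis using assms by metis
qed

lemma nu_mult_star:
  assumes "a \<in> T \<union> G" shows "\<nu> (a * star T \<nu> a) = \<nu> 1"
proof (cases "a \<in> T")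
  case True
  then show ?thesis by (simp add: star_def tangible_inverse_mem)
next
  case False
  then obtain t where t: "t \<in> T" "\<nu> t = a" using assms nu_onto by blast
  have inv: "\<nu> s * \<nu> (tangible_inverse T s) = \<nu> 1" if "s \<in> T" for s
    using tangible_inverse_mem(2)[OF that] by (metis nu_mult)
  \<comment> \<open>On ghosts \<open>star\<close> is well defined: the inverses of any two tangible
    lifts \<open>s\<close> and \<open>t\<close> of \<open>a\<close> have \<open>\<nu>\<close>-values
    that both invert \<open>a\<close> within \<open>G\<close>, so they agree after cancelling
    \<open>t\<close>.\<close>
  have "(THE c. \<exists>t\<in>T. \<nu> t = a \<and> c = \<nu> (tangible_inverse T t)) = \<nu> (tangible_inverse T t)"
  proof (rule the_equality)
    show "\<exists>s\<in>T. \<nu> s = a \<and> \<nu> (tangible_inverse T t) = \<nu> (tangible_inverse T s)" using t by blast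
    fix c assume "\<exists>s\<in>T. \<nu> s = a \<and> c = \<nu> (tangible_inverse T s)"
    then obtain s where s: "s \<in> T" "\<nu> s = a" "c = \<nu> (tangible_inverse T s)" by blast
    have "\<nu> (tangible_inverse T s * t) = \<nu> (tangible_inverse T t * t)"
      using inv[OF t(1)] inv[OF s(1)] s t by (simp add: nu_mult mult.commute)
    then show "c = \<nu> (tangible_inverse T t)" using nu_mult_cancel s(3) by blast
  qed
  then have "star T \<nu> a = \<nu> (tangible_inverse T t)" using False by (simp add: star_def)
  then show ?thesis using inv[OF t(1)] t nu_idem by (metis nu_mult)
qed

lemma nu_mult_star_eq_one_iff:
  assumes "b \<in> T \<union> G" shows "\<nu> (a * star T \<nu> b) = \<nu> 1 \<longleftrightarrow> \<nu> a = \<nu> b"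
  using nu_mult_star[OF assms] nu_mult_cancel[of a "star T \<nu> b" b] by (metis nu_mult)

text \<open>\<open>p\<close> is invertible and the ghosts form an ideal.\<close>

lemma mult_tangible_ghost_iff: "p \<in> T \<Longrightarrow> c * p \<in> G \<longleftrightarrow> c \<in> G"
  by (metis inverse_tangible mult.assoc mult.commute mult.right_neutral mult_ghost)

text \<open>Choose \<open>i\<close> with \<open>u i\<close> of maximal \<open>\<nu>\<close>-value.
  For \<open>k \<noteq> i\<close> the sum \<open>s k\<close> still contains \<open>u i\<close>,
  hence has its value, and \<open>u k\<close> is one of the summands of \<open>s i\<close>.\<close>

lemma eval_sum_dominant:
  assumes x: "x \<in> tangible_points T" and ms: "2 \<le> length ms" "fst ` set ms \<subseteq> T"
  defines "u \<equiv> \<lambda>k. eval_monomial (ms ! k) x"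
    and "s \<equiv> \<lambda>k. eval_sum (take k ms @ drop (Suc k) ms) x"
  obtains i where "i < length ms" "u i \<in> T" "s i \<preceq> u i"
    "\<forall>k<length ms. s k \<in> T \<union> G"
    "\<forall>k<length ms. k \<noteq> i \<longrightarrow> u k \<preceq> s i \<and> \<nu> (s k) = \<nu> (u i)"
    "eval_sum ms x = u i + s i"
proof -
  define xs where "xs = map (\<lambda>m. eval_monomial m x) ms"
  have s: "s k = sum1 (take k xs @ drop (Suc k) xs)" for k
    by (simp add: s_def xs_def eval_sum_def take_map drop_map)
  have u: "u k = xs ! k" if "k < length ms" for k using that by (simp add: u_def xs_def)
  have len: "length xs = length ms" by (simp add: xs_def)
  \<comment> \<open>Stated for lists of any type, as it is applied both to the monomials
    \<open>ms\<close> and to their values \<open>xs\<close>.\<close>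
  have ne: "take k ys @ drop (Suc k) ys \<noteq> []" if "k < length ms" "length ys = length ms" for k and ys :: "'c list"
    using that ms(1) by (cases k) auto
  have sub: "set (take k ys @ drop (Suc k) ys) \<subseteq> set ys" for k and ys :: "'c list"
    by (auto dest: in_set_takeD in_set_dropD)
  have "xs \<noteq> []" using ms(1) by (auto simp: xs_def)
  then obtain y where y: "y \<in> set xs" "\<forall>z\<in>set xs. z \<preceq> y" using ex_nu_max by blast
  then obtain i where i: "i < length ms" "u i = y" using u len by (metis in_set_conv_nth)
  have TG: "s k \<in> T \<union> G" if "k < length ms" for k
    unfolding s_def using ne[OF that, of ms] sub[of k ms] ms(2)
    by (intro eval_sum_mem_TG[OF x]) auto
  have s_le: "s k \<preceq> u i" if "k < length ms" for k
    unfolding s using ne[OF that len] sub[of k xs] y(2) i(2) by (intro sum1_nu_le) auto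
  have mem_le: "u j \<preceq> s k" if "j < length ms" "j \<noteq> k" for j k
    unfolding s using nth_in_remove_nth[of j xs k] that len u nu_le_sum1 by metis
  show ?thesis
  proof (rule that[OF i(1)])
    show "u i \<in> T" unfolding u_def using i(1) ms(2) by (intro eval_monomial_tangible[OF x]) auto
    show "s i \<preceq> u i" using s_le i(1) by blast
    show "\<forall>k<length ms. s k \<in> T \<union> G" using TG by blast
    show "\<forall>k<length ms. k \<noteq> i \<longrightarrow> u k \<preceq> s i \<and> \<nu> (s k) = \<nu> (u i)"
      using mem_le i(1) s_le nu_le_antisym by metis
    show "eval_sum ms x = u i + s i"
      using sum1_remove_nth[of i xs] i(1) len ms(1) u s unfolding eval_sum_def xs_def[symmetric]
      by metis
  qed
qed

text \<open>A strictly smaller \<open>s\<close> is absorbed and leaves the tangible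
  \<open>u\<close>, whereas equal values produce a ghost.\<close>

lemma ghost_add_iff:
  assumes "u \<in> T" "s \<preceq> u" shows "u + s \<in> G \<longleftrightarrow> \<nu> u = \<nu> s"
  using assms add_absorb add_equal nu_ghost tangible_not_ghost by (metis add.commute disjoint_iff)

lemma one_locus_hat:
  assumes "2 \<le> length ms" "fst ` set ms \<subseteq> T"
  shows "one_locus T \<nu> (hat T \<nu> ms) = corner_locus T G (eval_sum ms)"
proof -
  have "\<nu> (hat T \<nu> ms x) = \<nu> 1 \<longleftrightarrow> eval_sum ms x \<in> G" if x: "x \<in> tangible_points T" for x
  proof -
    let ?u = "\<lambda>k. eval_monomial (ms ! k) x"
    let ?s = "\<lambda>k. eval_sum (take k ms @ drop (Suc k) ms) x"
    obtain i where i: "i < length ms" "?u i \<in> T" "?s i \<preceq> ?u i"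
      and TG[rule_format]: "\<forall>k<length ms. ?s k \<in> T \<union> G"
      and k[rule_format]: "\<forall>k<length ms. k \<noteq> i \<longrightarrow> ?u k \<preceq> ?s i \<and> \<nu> (?s k) = \<nu> (?u i)"
      and sum: "eval_sum ms x = ?u i + ?s i"
      by (rule eval_sum_dominant[OF x assms])
    \<comment> \<open>The number 1 separates the summands of \<open>hat\<close>: the one at
      \<open>i\<close> is at least 1, all others are at most 1, so the one at \<open>i\<close>
      determines the \<open>\<nu>\<close>-value.\<close>
    have one: "1 \<preceq> ?u i * star T \<nu> (?s i)"
      using nu_le_mult[OF i(3), of "star T \<nu> (?s i)"] nu_mult_star[OF TG[OF i(1)]]
      by (simp add: nu_le_def mult.commute)
    have "\<nu> (hat T \<nu> ms x) = \<nu> (?u i * star T \<nu> (?s i))"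
      unfolding hat_def
    proof (rule nu_sum1_eqI)
      show "?u i * star T \<nu> (?s i) \<in> set (map (\<lambda>k. ?u k * star T \<nu> (?s k)) [0..<length ms])"
        using i(1) by auto
      fix y assume "y \<in> set (map (\<lambda>k. ?u k * star T \<nu> (?s k)) [0..<length ms])"
      then obtain j where j: "j < length ms" "y = ?u j * star T \<nu> (?s j)" by auto
      show "y \<preceq> ?u i * star T \<nu> (?s i)"
      proof (cases "j = i")
        case True
        then show ?thesis using j nu_le_refl by simp
      next
        case False
        have "?u j \<preceq> ?s j" using k[OF j(1) False] i(3) nu_le_trans nu_le_refl by metis
        then have "y \<preceq> 1"
          using nu_le_mult[of "?u j" "?s j" "star T \<nu> (?s j)"] nu_mult_star[OF TG[OF j(1)]] j(2)
          by (simp add: nu_le_def mult.commute)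
        then show ?thesis using one nu_le_trans by blast
      qed
    qed
    then show ?thesis
      using nu_mult_star_eq_one_iff[OF TG[OF i(1)]] sum ghost_add_iff[OF i(2,3)] by metis
  qed
  then show ?thesis by (auto simp: one_locus_def corner_locus_def)
qed

section \<open>Kernel roots of canonical fractions\<close>

lemma tangible_polynomials_mem_TG:
  assumes "g \<in> tangible_polynomials T" "x \<in> tangible_points T"
  shows "g x \<in> T \<union> G"
  using assms unfolding tangible_polynomials_def by (auto dest!: eval_sum_mem_TG)

lemma one_locus_fraction:
  assumes "g \<in> tangible_polynomials T"
  shows "one_locus T \<nu> (fraction T \<nu> h g) = {x \<in> tangible_points T. \<nu> (h x) = \<nu> (g x)}"
  unfolding one_locus_def fraction_def
  using nu_mult_star_eq_one_iff[OF tangible_polynomials_mem_TG[OF assms]] by blast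

text \<open>The left side does not mention \<open>h\<close> and \<open>g\<close>, so the corner
  locus on the right is the same for every canonical way of writing \<open>f\<close>.\<close>

lemma canonical_one_locus:
  assumes "canonical T \<nu> G f h g"
  shows "one_locus T \<nu> f = corner_locus T G (underline h g)"
proof -
  have f: "f = fraction T \<nu> h g" and g: "g \<in> tangible_polynomials T"
    using assms by (auto simp: canonical_def)
  have "one_locus T \<nu> f \<subseteq> corner_locus T G (underline h g)"
    unfolding f one_locus_fraction[OF g]
    by (auto simp: corner_locus_def underline_def) (metis add_equal nu_ghost)
  then show ?thesis using assms by (auto simp: canonical_def)
qed

section \<open>Hypersurfaces as kernel root sets\<close>

text \<open>Coefficients outside \<open>T \<union> G\<close> behave like tangible ones.\<close>

lemma ex_TG_coefficients:
  fixes ms :: "('a, 'n::finite) monomial list"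
  assumes "ms \<noteq> []"
  shows "\<exists>ns. ns \<noteq> [] \<and> fst ` set ns \<subseteq> T \<union> G \<and>
    corner_locus T G (eval_sum ns) = corner_locus T G (eval_sum ms)"
proof -
  \<comment> \<open>Ghosts are kept and every other element is replaced by a tangible one of equal
    \<open>\<nu>\<close>-value. Values and ghostness survive multiplication by the tangible power
    product, and then summation by \<open>ghost_add_cong\<close>.\<close>
  define lift where "lift c = (if c \<in> G then c else SOME t. t \<in> T \<and> \<nu> t = \<nu> c)" for c
  have lift: "lift c \<in> T \<union> G" "\<nu> (lift c) = \<nu> c" "lift c \<in> G \<longleftrightarrow> c \<in> G" for c
    using someI_ex[of "\<lambda>t. t \<in> T \<and> \<nu> t = \<nu> c"] ex_tangible_lift[of c] tangible_not_ghost
    by (auto simp: lift_def)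
  define ns where "ns = map (\<lambda>m. (lift (fst m), snd m)) ms"
  have mono: "\<nu> (eval_monomial (lift (fst m), snd m) x) = \<nu> (eval_monomial m x) \<and>
      (eval_monomial (lift (fst m), snd m) x \<in> G \<longleftrightarrow> eval_monomial m x \<in> G)"
    if "x \<in> tangible_points T" for m and x :: "'n \<Rightarrow> 'a"
  proof -
    have "(\<Prod>i\<in>UNIV. x i ^ snd m i) \<in> T"
      using that by (auto simp: tangible_points_def intro!: prod_tangible power_tangible)
    then show ?thesis by (simp add: eval_monomial_def nu_mult lift mult_tangible_ghost_iff)
  qed
  have "\<nu> (eval_sum (map (\<lambda>m. (lift (fst m), snd m)) ms) x) = \<nu> (eval_sum ms x) \<and>
      (eval_sum (map (\<lambda>m. (lift (fst m), snd m)) ms) x \<in> G \<longleftrightarrow> eval_sum ms x \<in> G)"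
    if "x \<in> tangible_points T" for x :: "'n \<Rightarrow> 'a"
    using assms
  proof (induction ms rule: list_nonempty_induct)
    case (single m)
    show ?case using mono[OF that, of m] by (simp add: eval_sum_singleton)
  next
    case (cons m ms)
    then have "map (\<lambda>m. (lift (fst m), snd m)) ms \<noteq> []" by simp
    then show ?case
      using cons mono[OF that, of m]
        ghost_add_cong[of "eval_monomial (lift (fst m), snd m) x" "eval_monomial m x"
          "eval_sum (map (\<lambda>m. (lift (fst m), snd m)) ms) x" "eval_sum ms x"]
      by (simp only: list.map eval_sum_Cons nu_add simp_thms)
  qed
  then have "corner_locus T G (eval_sum ns) = corner_locus T G (eval_sum ms)"
    by (auto simp: corner_locus_def ns_def)
  moreover have "fst ` set ns \<subseteq> T \<union> G" "ns \<noteq> []"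
    using assms by (simp_all add: ns_def image_subset_iff lift(1) del: Un_iff)
  ultimately show ?thesis by blast
qed

text \<open>The polynomial may change while its corner locus stays: coefficients are first moved
  into \<open>T \<union> G\<close>, then ghost monomials are split into tangible ones.\<close>

lemma hypersurface_sum_of_monomials:
  assumes "S \<in> hypersurfaces T G"
  shows "\<exists>f ms. f \<in> polynomials \<and> sum_of_monomials T f ms \<and> S = corner_locus T G f"
proof -
  obtain ms where "ms \<noteq> []" "S = corner_locus T G (eval_sum ms)"
    using assms by (auto simp: hypersurfaces_def polynomials_def)
  then obtain ns where ns: "ns \<noteq> []" "fst ` set ns \<subseteq> T \<union> G" "S = corner_locus T G (eval_sum ns)"
    using ex_TG_coefficients by metis
  then show ?thesis using ex_sum_of_monomials[OF ns(1,2)] polynomials_eval_sum[OF ns(1)] by blast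
qed

text \<open>At a tangible point with dominant value \<open>u\<close> and remaining sum
  \<open>s\<close>, the numerator has the \<open>\<nu>\<close>-value of \<open>u * u\<close> and the
  denominator that of \<open>u * s\<close>. The fraction thus has the \<open>\<nu>\<close>-value of
  \<open>u / s\<close>, as \<open>hat\<close> does, without a common denominator.\<close>

lemma ex_canonical_of_sum_of_monomials:
  fixes ms :: "('a, 'n::finite) monomial list"
  assumes ms: "2 \<le> length ms" "fst ` set ms \<subseteq> T"
  shows "\<exists>f h g. canonical T \<nu> G f h g \<and> one_locus T \<nu> f = corner_locus T G (eval_sum ms)"
proof -
  define h where "h x = eval_sum ms x * eval_sum ms x" for x :: "'n \<Rightarrow> 'a"
  define rest where "rest k = eval_sum (take k ms @ drop (Suc k) ms)" for k
  define p where "p x = sum1 (map (\<lambda>k. eval_monomial (ms ! k) x * rest k x) [0..<length ms])" for x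
  have ne: "ms \<noteq> []" using ms by auto
  have h: "h \<in> polynomials"
    using polynomials_mult polynomials_eval_sum ne unfolding h_def[abs_def] by blast
  have rest: "rest k \<in> polynomials" if "k < length ms" for k
    unfolding rest_def using that ms(1) by (intro polynomials_eval_sum) (cases k; auto)
  have "p \<in> polynomials"
    unfolding p_def[abs_def]
    using polynomials_sum1[of "[0..<length ms]" "\<lambda>k x. eval_monomial (ms ! k) x * rest k x"]
      polynomials_mult_monomial[OF rest] ne by auto
  then obtain g where g: "g \<in> tangible_polynomials T" "\<And>x. \<nu> (g x) = \<nu> (p x)"
    using ex_tangible_polynomial by blast
  have pt: "(\<nu> (h x) = \<nu> (g x) \<longleftrightarrow> eval_sum ms x \<in> G) \<and>
      (g x + h x \<in> G \<longrightarrow> eval_sum ms x \<in> G)" if x: "x \<in> tangible_points T" for x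
  proof -
    let ?u = "\<lambda>k. eval_monomial (ms ! k) x"
    obtain i where i: "i < length ms" "?u i \<in> T" "rest i x \<preceq> ?u i"
      and "\<forall>k<length ms. rest k x \<in> T \<union> G"
      and k[rule_format]: "\<forall>k<length ms. k \<noteq> i \<longrightarrow> ?u k \<preceq> rest i x \<and> \<nu> (rest k x) = \<nu> (?u i)"
      and sum: "eval_sum ms x = ?u i + rest i x"
      by (rule eval_sum_dominant[OF x ms, folded rest_def])
    have "\<nu> (p x) = \<nu> (?u i * rest i x)"
      unfolding p_def
    proof (rule nu_sum1_eqI)
      show "?u i * rest i x \<in> set (map (\<lambda>k. ?u k * rest k x) [0..<length ms])"
        using i(1) by auto
      fix y assume "y \<in> set (map (\<lambda>k. ?u k * rest k x) [0..<length ms])"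
      then obtain j where j: "j < length ms" "y = ?u j * rest j x" by auto
      show "y \<preceq> ?u i * rest i x"
      proof (cases "j = i")
        case True
        then show ?thesis using j nu_le_refl by simp
      next
        case False
        \<comment> \<open>For \<open>j \<noteq> i\<close> the rest has the value of
          \<open>?u i\<close>, and \<open>?u j\<close> is at most \<open>rest i x\<close>.\<close>
        have "\<nu> y = \<nu> (?u i * ?u j)" using k[OF j(1) False] j(2) by (simp add: nu_mult mult.commute)
        then show ?thesis using nu_le_mult k[OF j(1) False] nu_le_refl nu_le_trans by metis
      qed
    qed
    then have gx: "\<nu> (g x) = \<nu> (?u i * rest i x)" using g(2) by simp
    have "\<nu> (eval_sum ms x) = \<nu> (?u i)"
      using nu_add_of_nu_le[OF i(3)] sum by (simp add: add.commute)
    then have hx: "\<nu> (h x) = \<nu> (?u i * ?u i)" by (simp add: h_def nu_mult)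
    \<comment> \<open>Cancelling the common factor \<open>?u i\<close> leaves the comparison of
      \<open>?u i\<close> with \<open>rest i x\<close>.\<close>
    have iff: "\<nu> (h x) = \<nu> (g x) \<longleftrightarrow> eval_sum ms x \<in> G"
      using gx hx sum ghost_add_iff[OF i(2,3)] nu_mult_cancel by (metis mult.commute nu_mult)
    \<comment> \<open>This is canonicity in contrapositive form: here \<open>h x\<close> is tangible
      and strictly dominates \<open>g x\<close>, which is therefore absorbed.\<close>
    moreover have "g x + h x \<notin> G" if "eval_sum ms x \<notin> G"
    proof -
      have "eval_sum ms x = ?u i"
        using that sum i(3) add_absorb ghost_add_iff[OF i(2,3)] by (metis add.commute)
      then have "h x \<in> T" using i(2) mult_tangible by (simp add: h_def)
      moreover have "g x \<preceq> h x" using nu_le_mult[OF i(3), of "?u i"] gx hx by (simp add: nu_le_def)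
      ultimately show ?thesis using add_absorb that iff tangible_not_ghost by (metis disjoint_iff)
    qed
    ultimately show ?thesis by blast
  qed
  have "one_locus T \<nu> (fraction T \<nu> h g) = corner_locus T G (eval_sum ms)"
    unfolding one_locus_fraction[OF g(1)] corner_locus_def using pt by blast
  moreover have "corner_locus T G (underline h g) \<subseteq> corner_locus T G (eval_sum ms)"
    unfolding underline_def corner_locus_def using pt by blast
  ultimately show ?thesis using h g(1) unfolding canonical_def by blast
qed

text \<open>Equality of the two collections makes the identity a bijection in both
  directions.\<close>

lemma hypersurfaces_eq_corner_internal_one_sets:
  "(hypersurfaces T G :: ('n::finite \<Rightarrow> 'a) set set) = corner_internal_one_sets T \<nu> G"
proof (intro subset_antisym subsetI)
  fix S :: "('n \<Rightarrow> 'a) set" assume "S \<in> hypersurfaces T G"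
  then obtain f ms where "sum_of_monomials T f ms" "S = corner_locus T G f"
    using hypersurface_sum_of_monomials by blast
  then show "S \<in> corner_internal_one_sets T \<nu> G"
    using ex_canonical_of_sum_of_monomials[of ms]
    unfolding sum_of_monomials_def corner_internal_one_sets_def corner_internal_def by blast
next
  fix S :: "('n \<Rightarrow> 'a) set" assume "S \<in> corner_internal_one_sets T \<nu> G"
  then obtain f h g where c: "canonical T \<nu> G f h g" "S = one_locus T \<nu> f"
    by (auto simp: corner_internal_one_sets_def corner_internal_def)
  have "h \<in> polynomials" "g \<in> polynomials"
    using c(1) by (auto simp: canonical_def tangible_polynomials_def polynomials_def)
  then have "underline h g \<in> polynomials"
    unfolding underline_def[abs_def] using polynomials_add by blast
  then show "S \<in> hypersurfaces T G"
    using canonical_one_locus[OF c(1)] c(2) by (auto simp: hypersurfaces_def)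
qed

end

theorem theorem7p1p7:
  fixes T G :: "'a::{comm_semiring, comm_monoid_mult} set"
    and \<nu> :: "'a \<Rightarrow> 'a"
    and ord :: "('a \<times> 'a) set"
  assumes "nu_semifield T \<nu> G ord"
  shows "\<exists>\<Phi> \<Psi> :: ('n::finite \<Rightarrow> 'a) set \<Rightarrow> ('n \<Rightarrow> 'a) set.
      (\<forall>f ms. f \<in> polynomials \<and> sum_of_monomials T f ms \<longrightarrow>
          \<Phi> (corner_locus T G f) = one_locus T \<nu> (hat T \<nu> ms)) \<and>
      (\<forall>S \<in> hypersurfaces T G. \<exists>f :: ('n \<Rightarrow> 'a) \<Rightarrow> 'a. \<exists>ms. f \<in> polynomials \<and> sum_of_monomials T f ms \<and>
          S = corner_locus T G f) \<and>
      (\<forall>f h g. corner_internal T \<nu> G f \<and> canonical T \<nu> G f h g \<longrightarrow>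
          \<Psi> (one_locus T \<nu> f) = corner_locus T G (underline h g)) \<and>
      bij_betw \<Phi> (hypersurfaces T G) (corner_internal_one_sets T \<nu> G) \<and>
      bij_betw \<Psi> (corner_internal_one_sets T \<nu> G) (hypersurfaces T G) \<and>
      (\<forall>S \<in> hypersurfaces T G. \<Psi> (\<Phi> S) = S) \<and>
      (\<forall>S \<in> corner_internal_one_sets T \<nu> G. \<Phi> (\<Psi> S) = S)"
proof -
  interpret nu_semifield T \<nu> G ord by (fact assms)
  have hat: "corner_locus T G f = one_locus T \<nu> (hat T \<nu> ms)"
    if "sum_of_monomials T f ms" for f :: "('n \<Rightarrow> 'a) \<Rightarrow> 'a" and ms
    using that one_locus_hat[of ms] by (simp add: sum_of_monomials_def)
  show ?thesis
  \<comment> \<open>Both \<open>\<Phi>\<close> and \<open>\<Psi>\<close> are instantiated with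
    \<open>id\<close>.\<close>
  proof (intro exI[of _ id] conjI ballI allI impI)
    fix S :: "('n \<Rightarrow> 'a) set" assume "S \<in> hypersurfaces T G"
    then show "\<exists>f ms. f \<in> polynomials \<and> sum_of_monomials T f ms \<and> S = corner_locus T G f"
      by (rule hypersurface_sum_of_monomials)
  qed (simp_all add: hat canonical_one_locus hypersurfaces_eq_corner_internal_one_sets)
qed

end
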